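(* Let $A_0,\dots,A_n\in\mathcal S^p$ be such that the system $\mathcal A(\mathbf x)\in\mathcal{COP}^p$ is consistent, and let $Y^*$ be a maximum slack in this system. The condition A1) the set $L:=\mathrm{cone}\{\mathbf a(\mathbf t):\mathbf t\in T_{im}\}$ is a (linear) subspace is equivalent to the following condition: A3) there is a matrix $U^*\in\mathcal N(\mathcal B^* )\cap\mathcal{CP}^p$ strictly complementary to $Y^*$.
   Context: Fix integers $p>1$, $n\ge 1$. $\mathcal S^p$ is the space of real symmetric $p\times p$ matrices with $A\bullet B=\mathrm{trace}(AB)$; $\mathbb R^p_+$ is the set of vectors with non-negative components; $T=\{\mathbf t\in\mathbb R^p_+:\sum_{k=1}^p t_k=1\}$; $\mathcal{COP}^p=\{D\in\mathcal S^p:\mathbf t^\top D\mathbf t\ge 0\ \forall \mathbf t\in\mathbb R^p_+\}$; $\mathcal{CP}^p=\mathrm{conv}\{\mathbf t\mathbf t^\top:\mathbf t\in\mathbb R^p_+\}$. For a set $\mathcal B$, $\mathrm{cone}\,\mathcal B$ is the set of all finite linear combinations of elements of $\mathcal B$ with non-negative coefficients (so $\mathrm{cone}\,\emptyset=\{0\}$). Given $A_0,\dots,A_n\in\mathcal S^p$, put $\mathcal A(\mathbf x)=A_0+\sum_{m=1}^n x_mA_m$ for $\mathbf x\in\mathbb R^n$ and $X=\{\mathbf x\in\mathbb R^n:\mathcal A(\mathbf x)\in\mathcal{COP}^p\}$. The system is consistent if $X\ne\emptyset$. $T_{im}=\{\mathbf t\in T:\mathbf t^\top\mathcal A(\mathbf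 x)\mathbf t=0\ \forall\mathbf x\in X\}$ is the set of normalized immobile indices. For $\mathbf t\in T$: $\mathbf a(\mathbf t)=(\mathbf t^\top A_m\mathbf t)_{m=0,\dots,n}\in\mathbb R^{n+1}$. A matrix $Y$ is a maximum slack in the system $\mathcal A(\mathbf x)\in\mathcal{COP}^p$ if $Y\in\mathrm{relint}\,\mathcal D$, where $\mathcal D=\{\mathcal A(\mathbf x):\mathbf x\in X\}$ and $\mathrm{relint}$ denotes the relative interior. For $Y\in\mathcal{COP}^p$, $Y^\perp=\{U\in\mathcal S^p:Y\bullet U=0\}$, and $U\in\mathcal{CP}^p$ is strictly complementary to $Y$ if $U\in\mathrm{relint}(\mathcal{CP}^p\cap Y^\perp)$. $\mathcal N(\mathcal B^* )=\{U\in\mathcal S^p:A_m\bullet U=0\ \forall m=0,1,\dots,n\}$. *)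

theory Defs
  imports "HOL-Analysis.Analysis"
begin

definition sym_mats :: "(real^'p^'p) set" where
  "sym_mats = {D. transpose D = D}"

definition mat_inner :: "real^'p^'p \<Rightarrow> real^'p^'p \<Rightarrow> real" where
  "mat_inner A B = trace (A ** B)"

definition nonneg_vecs :: "(real^'p) set" where
  "nonneg_vecs = {t. \<forall>k. 0 \<le> t $ k}"

definition index_simplex :: "(real^'p) set" where
  "index_simplex = {t \<in> nonneg_vecs. (\<Sum>k\<in>UNIV. t $ k) = 1}"

definition quad_form :: "real^'p^'p \<Rightarrow> real^'p \<Rightarrow> real" where
  "quad_form D t = t \<bullet> (D *v t)"

definition outer_sq :: "real^'p \<Rightarrow> real^'p^'p" where
  "outer_sq t = (\<chi> i j. t $ i * t $ j)"

definition COP :: "(real^'p^'p) set" where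
  "COP = {D \<in> sym_mats. \<forall>t\<in>nonneg_vecs. 0 \<le> quad_form D t}"

definition CP :: "(real^'p^'p) set" where
  "CP = convex hull (outer_sq ` nonneg_vecs)"

text \<open>All finite non-negative combinations, including the empty one. This is not the
  library's \<^term>\<open>cone hull B\<close>, which contains only the multiples of single
  elements and is empty for empty \<open>B\<close>.\<close>

definition gen_cone :: "'a::real_vector set \<Rightarrow> 'a set" where
  "gen_cone B = {\<Sum>b\<in>F. c b *\<^sub>R b | F c. finite F \<and> F \<subseteq> B \<and> (\<forall>b\<in>F. (0::real) \<le> c b)}"

text \<open>A family \<open>A\<^sub>0, \<dots>, A\<^sub>n\<close> is indexed by \<^typ>\<open>'n option\<close> with \<open>CARD('n) = n\<close>:
  \<^term>\<open>None\<close> is the index \<open>0\<close>, and \<open>Some m\<close> ranges over the indices \<open>1, \<dots>, n\<close>.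
  Accordingly \<open>real^('n option)\<close> is the \<open>n + 1\<close>-dimensional space containing the vectors
  \<open>a(t)\<close>.\<close>

definition mat_pencil :: "('n::finite option \<Rightarrow> real^'p^'p) \<Rightarrow> real^'n \<Rightarrow> real^'p^'p" where
  "mat_pencil A x = A None + (\<Sum>m\<in>UNIV. x $ m *\<^sub>R A (Some m))"

definition feasible_set :: "('n::finite option \<Rightarrow> real^'p^'p) \<Rightarrow> (real^'n) set" where
  "feasible_set A = {x. mat_pencil A x \<in> COP}"

definition consistent :: "('n::finite option \<Rightarrow> real^'p^'p) \<Rightarrow> bool" where
  "consistent A \<longleftrightarrow> feasible_set A \<noteq> {}"

definition immobile_indices :: "('n::finite option \<Rightarrow> real^'p^'p) \<Rightarrow> (real^'p) set" where
  "immobile_indices A =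
     {t \<in> index_simplex. \<forall>x\<in>feasible_set A. quad_form (mat_pencil A x) t = 0}"

definition coeff_vec :: "('n::finite option \<Rightarrow> real^'p^'p) \<Rightarrow> real^'p \<Rightarrow> real^('n option)" where
  "coeff_vec A t = (\<chi> m. quad_form (A m) t)"

definition max_slack :: "('n::finite option \<Rightarrow> real^'p^'p) \<Rightarrow> real^'p^'p \<Rightarrow> bool" where
  "max_slack A Y \<longleftrightarrow> Y \<in> rel_interior (mat_pencil A ` feasible_set A)"

definition mat_perp :: "real^'p^'p \<Rightarrow> (real^'p^'p) set" where
  "mat_perp Y = {U \<in> sym_mats. mat_inner Y U = 0}"

definition strictly_complementary :: "real^'p^'p \<Rightarrow> real^'p^'p \<Rightarrow> bool" where
  "strictly_complementary U Y \<longleftrightarrow> U \<in> rel_interior (CP \<inter> mat_perp Y)"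

definition null_mats :: "('n::finite option \<Rightarrow> real^'p^'p) \<Rightarrow> (real^'p^'p) set" where
  "null_mats A = {U \<in> sym_mats. \<forall>m. mat_inner (A m) U = 0}"

end

theory Submission
  imports Defs
begin

text \<open>
  Both conditions speak about one linear map, \<open>\<phi>(U) = (A\<^sub>m \<bullet> U)\<^sub>m\<close>, applied to one convex
  cone, the face \<open>K = CP \<inter> Y*\<^sup>\<bottom>\<close> of the completely positive cone.

  A linear functional that is non-negative on a convex set and vanishes at a relative interior
  point vanishes on the whole set. For the functional \<open>D \<mapsto> t\<^sup>T D t\<close> on the set of all slacks,
  this says that the normalized immobile indices are exactly the zeros of the form of \<open>Y*\<close> in
  the simplex. Since \<open>Y*\<close> is copositive, a completely positive matrix orthogonal to it is built
  from zeros of that form only, so the matrices \<open>t t\<^sup>T\<close> with \<open>t\<close> immobile generate \<open>K\<close>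
  (\<open>CP_face_eq_convex_cone_hull\<close>). As \<open>\<phi>\<close> sends \<open>t t\<^sup>T\<close> to \<open>a(t)\<close>, the cone \<open>L\<close> of
  condition A1 is the image \<open>\<phi>(K)\<close>.

  A convex cone is a subspace if and only if \<open>0\<close> is in its relative interior
  (\<open>subspace_iff_zero_in_rel_interior\<close>), and linear maps commute with the relative interior of
  convex sets. Hence \<open>L\<close> is a subspace if and only if some \<open>U\<close> in the relative interior of \<open>K\<close>
  satisfies \<open>\<phi>(U) = 0\<close>, which is condition A3.
\<close>

section \<open>Convex cones and relative interiors\<close>

lemma gen_cone_eq_convex_cone_hull: "gen_cone B = convex_cone hull B"
proof
  show "gen_cone B \<subseteq> convex_cone hull B"
  proof
    fix x assume "x \<in> gen_cone B"
    then obtain F c where F: "finite F" "F \<subseteq> B" "\<forall>b\<in>F. (0::real) \<le> c b"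
      and x: "x = (\<Sum>b\<in>F. c b *\<^sub>R b)"
      unfolding gen_cone_def by blast
    have "(\<Sum>b\<in>F. c b *\<^sub>R b) \<in> convex_cone hull B"
      using F
      by (induction F rule: finite_induct)
         (auto intro: convex_cone_hull_add convex_cone_hull_mul hull_inc
            simp: convex_cone_hull_contains_0)
    with x show "x \<in> convex_cone hull B" by simp
  qed
next
  show "convex_cone hull B \<subseteq> gen_cone B"
  proof (rule hull_minimal)
    show "B \<subseteq> gen_cone B"
    proof
      fix b assume "b \<in> B"
      then show "b \<in> gen_cone B"
        unfolding gen_cone_def
        by (intro CollectI exI[of _ "{b}"] exI[of _ "\<lambda>_. 1"]) auto
    qed
    show "convex_cone (gen_cone B)"
      unfolding convex_cone_iff
    proof (intro conjI ballI allI impI)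
      show "0 \<in> gen_cone B"
        unfolding gen_cone_def by (intro CollectI exI[of _ "{}"]) auto
    next
      fix x y assume "x \<in> gen_cone B" "y \<in> gen_cone B"
      then obtain F c G d where F: "finite F" "F \<subseteq> B" "\<forall>b\<in>F. (0::real) \<le> c b"
        and x: "x = (\<Sum>b\<in>F. c b *\<^sub>R b)"
        and G: "finite G" "G \<subseteq> B" "\<forall>b\<in>G. (0::real) \<le> d b"
        and y: "y = (\<Sum>b\<in>G. d b *\<^sub>R b)"
        unfolding gen_cone_def by blast
      \<comment> \<open>The two supports may overlap, so coefficients are extended by zero and added.\<close>
      let ?c = "\<lambda>b. if b \<in> F then c b else 0" and ?d = "\<lambda>b. if b \<in> G then d b else 0"
      have "x = (\<Sum>b\<in>F \<union> G. ?c b *\<^sub>R b)"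
        unfolding x using F(1) G(1) by (intro sum.mono_neutral_cong_left) auto
      moreover have "y = (\<Sum>b\<in>F \<union> G. ?d b *\<^sub>R b)"
        unfolding y using F(1) G(1) by (intro sum.mono_neutral_cong_left) auto
      ultimately have "x + y = (\<Sum>b\<in>F \<union> G. (?c b + ?d b) *\<^sub>R b)"
        by (simp only: scaleR_add_left sum.distrib)
      then show "x + y \<in> gen_cone B"
        unfolding gen_cone_def using F G
        by (intro CollectI exI[of _ "F \<union> G"] exI[of _ "\<lambda>b. ?c b + ?d b"]) auto
    next
      fix x and r :: real assume "x \<in> gen_cone B" and r: "0 \<le> r"
      then obtain F c where F: "finite F" "F \<subseteq> B" "\<forall>b\<in>F. (0::real) \<le> c b"
        and x: "x = (\<Sum>b\<in>F. c b *\<^sub>R b)"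
        unfolding gen_cone_def by blast
      then show "r *\<^sub>R x \<in> gen_cone B"
        unfolding gen_cone_def using r
        by (intro CollectI exI[of _ F] exI[of _ "\<lambda>b. r * c b"]) (auto simp: scaleR_sum_right)
    qed
  qed
qed

text \<open>If \<open>0\<close> is a relative interior point, every segment from \<open>x\<close> to \<open>0\<close> can be prolonged
  beyond \<open>0\<close> inside the cone, and rescaling the prolongation yields \<open>- x\<close>.\<close>

lemma subspace_iff_zero_in_rel_interior:
  fixes S :: "'a::euclidean_space set"
  assumes "convex_cone S"
  shows "subspace S \<longleftrightarrow> 0 \<in> rel_interior S"
proof
  assume "subspace S"
  then show "0 \<in> rel_interior S"
    by (simp add: rel_interior_affine subspace_imp_affine subspace_0)
next
  assume "0 \<in> rel_interior S"
  moreover have "convex S" "S \<noteq> {}"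
    using assms by (auto simp: convex_cone_def)
  ultimately have prolong: "\<exists>e>1. (1 - e) *\<^sub>R x \<in> S" if "x \<in> S" for x
    using that convex_rel_interior_iff[of S 0] by auto
  have neg: "- x \<in> S" if x: "x \<in> S" for x
  proof -
    obtain e where e: "e > 1" "(1 - e) *\<^sub>R x \<in> S"
      using prolong[OF x] by blast
    then have "(1 / (e - 1)) *\<^sub>R ((1 - e) *\<^sub>R x) \<in> S"
      using convex_cone_scaleR[OF assms _ e(2), of "1 / (e - 1)"] by simp
    moreover have "1 / (e - 1) * (1 - e) = - 1"
      using e(1) by (simp add: field_simps)
    ultimately show ?thesis
      by (simp only: scaleR_scaleR) simp
  qed
  show "subspace S"
    unfolding subspace_def
  proof (intro conjI ballI allI)
    show "0 \<in> S" using assms by (rule convex_cone_contains_0)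
    show "x + y \<in> S" if "x \<in> S" "y \<in> S" for x y
      using assms that by (rule convex_cone_add)
    fix c :: real and x assume x: "x \<in> S"
    show "c *\<^sub>R x \<in> S"
    proof (cases "0 \<le> c")
      case True
      then show ?thesis using assms x by (simp add: convex_cone_scaleR)
    next
      case False
      then have "(- c) *\<^sub>R (- x) \<in> S"
        using assms neg[OF x] by (intro convex_cone_scaleR) auto
      then show ?thesis by simp
    qed
  qed
qed

lemma linear_nonneg_vanishes_on_convex:
  fixes f :: "'a::euclidean_space \<Rightarrow> real"
  assumes "linear f" "convex S" "\<And>x. x \<in> S \<Longrightarrow> 0 \<le> f x"
    and z: "z \<in> rel_interior S" "f z = 0" and x: "x \<in> S"
  shows "f x = 0"
proof -
  obtain e where e: "e > 1" "(1 - e) *\<^sub>R x + e *\<^sub>R z \<in> S"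
    using convex_rel_interior_iff[of S z] assms by auto
  have "f ((1 - e) *\<^sub>R x + e *\<^sub>R z) = (1 - e) * f x"
    using assms(1) z(2) by (simp add: linear_add linear_scale)
  with assms(3)[OF e(2)] have "0 \<le> (1 - e) * f x" by simp
  with e(1) have "f x \<le> 0" by (simp add: zero_le_mult_iff)
  with assms(3)[OF x] show ?thesis by simp
qed

section \<open>Completely positive matrices and their faces\<close>

lemma linear_mat_inner: "linear (mat_inner Y)"
  by (rule linearI)
     (simp_all add: mat_inner_def trace_def matrix_matrix_mult_def sum.distrib algebra_simps
        sum_distrib_left)

lemma linear_quad_form: "linear (\<lambda>D. quad_form D t)"
  by (rule linearI)
     (simp_all add: quad_form_def matrix_vector_mult_add_rdistrib inner_add_right
        scaleR_matrix_vector_assoc[symmetric])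

lemma mat_inner_outer_sq: "mat_inner Y (outer_sq t) = quad_form Y t"
  by (simp add: mat_inner_def outer_sq_def quad_form_def trace_def matrix_matrix_mult_def
      matrix_vector_mult_def inner_vec_def sum_distrib_left mult_ac)

lemma outer_sq_scaleR: "outer_sq (s *\<^sub>R t) = s\<^sup>2 *\<^sub>R outer_sq t"
  by (simp add: outer_sq_def vec_eq_iff power2_eq_square)

lemma outer_sq_sym: "outer_sq t \<in> sym_mats"
  by (simp add: outer_sq_def sym_mats_def transpose_def vec_eq_iff mult.commute)

lemma subspace_sym_mats: "subspace sym_mats"
  by (auto simp: subspace_def sym_mats_def transpose_def vec_eq_iff)

text \<open>The generators of \<open>CP\<close> are closed under non-negative scaling because \<open>c\<close> times the outer
  square of \<open>t\<close> is the outer square of \<open>\<surd>c t\<close>; so the convex hull is already a cone.\<close>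

lemma convex_cone_CP: "convex_cone (CP :: (real^'p^'p) set)"
proof -
  have "cone (outer_sq ` (nonneg_vecs :: (real^'p) set))"
    unfolding cone_def
  proof (intro ballI allI impI)
    fix U :: "real^'p^'p" and c :: real
    assume "U \<in> outer_sq ` nonneg_vecs" and c: "0 \<le> c"
    then obtain t where t: "t \<in> nonneg_vecs" "U = outer_sq t" by blast
    then have "c *\<^sub>R U = outer_sq (sqrt c *\<^sub>R t)" "sqrt c *\<^sub>R t \<in> nonneg_vecs"
      using c by (auto simp: outer_sq_scaleR nonneg_vecs_def)
    then show "c *\<^sub>R U \<in> outer_sq ` nonneg_vecs" by blast
  qed
  then have "cone (CP :: (real^'p^'p) set)"
    unfolding CP_def by (rule cone_convex_hull)
  moreover have "(0::real^'p) \<in> nonneg_vecs" by (simp add: nonneg_vecs_def)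
  then have "(CP :: (real^'p^'p) set) \<noteq> {}" by (auto simp: CP_def)
  moreover have "convex (CP :: (real^'p^'p) set)" by (simp add: CP_def)
  ultimately show ?thesis
    by (simp add: convex_cone_def conic_def cone_def)
qed

lemma CP_sym: "CP \<subseteq> sym_mats"
  unfolding CP_def
  by (intro hull_minimal) (auto simp: outer_sq_sym subspace_sym_mats subspace_imp_convex)

lemma convex_cone_CP_face: "convex_cone (CP \<inter> mat_perp Y)"
  using convex_cone_CP subspace_sym_mats linear_mat_inner[of Y]
  by (auto simp: convex_cone_iff mat_perp_def subspace_def linear_0 linear_add linear_scale)

lemma nonneg_vec_normalize:
  assumes "t \<in> nonneg_vecs" "t \<noteq> 0"
  obtains s u where "s > 0" "u \<in> index_simplex" "t = s *\<^sub>R u"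
proof
  let ?s = "\<Sum>k\<in>UNIV. t $ k"
  have "0 \<le> ?s" using assms(1) by (auto simp: nonneg_vecs_def intro: sum_nonneg)
  moreover have "?s \<noteq> 0"
    using assms by (auto simp: nonneg_vecs_def sum_nonneg_eq_0_iff vec_eq_iff)
  ultimately show s: "?s > 0" by simp
  then show "(1 / ?s) *\<^sub>R t \<in> index_simplex"
    using assms(1)
    by (auto simp: index_simplex_def nonneg_vecs_def sum_divide_distrib[symmetric])
  show "t = ?s *\<^sub>R ((1 / ?s) *\<^sub>R t)" using s by simp
qed

text \<open>In a convex combination of matrices \<open>t t\<^sup>T\<close> orthogonal to the copositive matrix \<open>Y\<close>, all
  terms contribute \<open>t\<^sup>T Y t \<ge> 0\<close> to a vanishing sum, so every term with positive weight is
  orthogonal to \<open>Y\<close> by itself.\<close>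

lemma CP_face_eq_convex_cone_hull:
  fixes Y :: "real^'p^'p"
  assumes Y: "Y \<in> COP"
  shows "CP \<inter> mat_perp Y =
    convex_cone hull (outer_sq ` {t \<in> index_simplex. quad_form Y t = 0})" (is "_ = ?K")
proof
  let ?f = "mat_inner Y"
  \<comment> \<open>The set \<open>?P\<close> turns the claim about weights into a convex property, so that it need be
    checked on generators only.\<close>
  let ?P = "{U. 0 \<le> ?f U \<and> (?f U = 0 \<longrightarrow> U \<in> ?K)}"
  have "CP \<subseteq> ?P"
    unfolding CP_def
  proof (rule hull_minimal)
    show "outer_sq ` nonneg_vecs \<subseteq> ?P"
    proof
      fix U :: "real^'p^'p" assume "U \<in> outer_sq ` nonneg_vecs"
      then obtain t where t: "t \<in> nonneg_vecs" "U = outer_sq t" by blast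
      have "U \<in> ?K" if zero: "?f U = 0"
      proof (cases "t = 0")
        case True
        then have "U = 0" using t by (simp add: outer_sq_def vec_eq_iff)
        then show ?thesis by (simp add: convex_cone_hull_contains_0)
      next
        case False
        then obtain s u where s: "s > 0" "u \<in> index_simplex" "t = s *\<^sub>R u"
          using nonneg_vec_normalize[OF t(1)] by blast
        then have U: "U = s\<^sup>2 *\<^sub>R outer_sq u" using t(2) by (simp add: outer_sq_scaleR)
        have "quad_form Y u = 0"
          using zero s(1) U by (simp add: linear_scale[OF linear_mat_inner] mat_inner_outer_sq)
        then show ?thesis
          unfolding U using s(2) by (intro convex_cone_hull_mul hull_inc) auto
      qed
      moreover have "0 \<le> ?f U" using Y t by (auto simp: COP_def mat_inner_outer_sq)
      ultimately show "U \<in> ?P" by blast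
    qed
    show "convex ?P"
    proof (rule convexI)
      fix U V :: "real^'p^'p" and a b :: real
      assume U: "U \<in> ?P" and V: "V \<in> ?P" and ab: "0 \<le> a" "0 \<le> b" "a + b = 1"
      have val: "?f (a *\<^sub>R U + b *\<^sub>R V) = a * ?f U + b * ?f V"
        by (simp add: linear_add[OF linear_mat_inner] linear_scale[OF linear_mat_inner])
      have pos: "0 \<le> a * ?f U" "0 \<le> b * ?f V" using U V ab by auto
      have "a *\<^sub>R U + b *\<^sub>R V \<in> ?K" if "?f (a *\<^sub>R U + b *\<^sub>R V) = 0"
      proof (rule convex_cone_hull_add)
        have "a * ?f U = 0" "b * ?f V = 0" using that val pos by linarith+
        then have "a = 0 \<or> U \<in> ?K" "b = 0 \<or> V \<in> ?K" using U V by auto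
        then show "a *\<^sub>R U \<in> ?K" "b *\<^sub>R V \<in> ?K"
          using ab(1,2) by (auto simp: convex_cone_hull_contains_0 convex_cone_hull_mul)
      qed
      then show "a *\<^sub>R U + b *\<^sub>R V \<in> ?P" using val pos by simp
    qed
  qed
  then show "CP \<inter> mat_perp Y \<subseteq> ?K" by (auto simp: mat_perp_def)
next
  have "outer_sq t \<in> CP" if "t \<in> index_simplex" for t :: "real^'p"
    using that unfolding CP_def index_simplex_def by (intro hull_inc) blast
  then show "?K \<subseteq> CP \<inter> mat_perp Y"
    by (intro hull_minimal convex_cone_CP_face)
       (auto simp: mat_perp_def outer_sq_sym mat_inner_outer_sq)
qed

section \<open>Immobile indices and maximum slacks\<close>

lemma convex_COP: "convex COP"
proof (rule convexI)
  fix C D :: "real^'p^'p" and a b :: real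
  assume CD: "C \<in> COP" "D \<in> COP" and ab: "0 \<le> a" "0 \<le> b" "a + b = 1"
  have "a *\<^sub>R C + b *\<^sub>R D \<in> sym_mats"
    using CD by (auto simp: COP_def intro: subspace_add subspace_scale subspace_sym_mats)
  then show "a *\<^sub>R C + b *\<^sub>R D \<in> COP"
    using CD ab
    by (auto simp: COP_def linear_add[OF linear_quad_form] linear_scale[OF linear_quad_form])
qed

lemma convex_slacks:
  fixes A :: "'n::finite option \<Rightarrow> real^'p^'p"
  shows "convex (mat_pencil A ` feasible_set A)"
proof (rule convexI)
  fix C D :: "real^'p^'p" and a b :: real
  assume "C \<in> mat_pencil A ` feasible_set A" "D \<in> mat_pencil A ` feasible_set A"
    and ab: "0 \<le> a" "0 \<le> b" "a + b = 1"
  then obtain x y where x: "C = mat_pencil A x" "C \<in> COP" and y: "D = mat_pencil A y" "D \<in> COP"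
    by (auto simp: feasible_set_def)
  have "A None = a *\<^sub>R A None + b *\<^sub>R A None"
    using ab(3) by (simp add: scaleR_add_left[symmetric])
  then have "mat_pencil A (a *\<^sub>R x + b *\<^sub>R y) = a *\<^sub>R C + b *\<^sub>R D"
    unfolding x y mat_pencil_def
    by (simp add: scaleR_add_left scaleR_add_right sum.distrib scaleR_sum_right)
  moreover have "a *\<^sub>R C + b *\<^sub>R D \<in> COP"
    using convex_COP x(2) y(2) ab by (rule convexD)
  ultimately show "a *\<^sub>R C + b *\<^sub>R D \<in> mat_pencil A ` feasible_set A"
    by (metis (mono_tags, lifting) feasible_set_def imageI mem_Collect_eq)
qed

lemma max_slack_COP: "max_slack A Y \<Longrightarrow> Y \<in> COP"
  using rel_interior_subset[of "mat_pencil A ` feasible_set A"]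
  by (auto simp: max_slack_def feasible_set_def)

lemma immobile_indices_eq_zeros:
  assumes "max_slack A Y"
  shows "immobile_indices A = {t \<in> index_simplex. quad_form Y t = 0}"
proof -
  let ?D = "mat_pencil A ` feasible_set A"
  have Y: "Y \<in> rel_interior ?D" using assms by (simp add: max_slack_def)
  then have "Y \<in> ?D" using rel_interior_subset by blast
  moreover have "quad_form D t = 0"
    if "t \<in> index_simplex" "quad_form Y t = 0" "D \<in> ?D" for D t
    using linear_quad_form convex_slacks _ Y that(2,3)
  proof (rule linear_nonneg_vanishes_on_convex)
    show "0 \<le> quad_form C t" if "C \<in> ?D" for C
      using that \<open>t \<in> index_simplex\<close> by (auto simp: feasible_set_def COP_def index_simplex_def)
  qed
  ultimately show ?thesis unfolding immobile_indices_def by blast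
qed

section \<open>The equivalence\<close>

theorem proposition7:
  fixes A :: "'n::finite option \<Rightarrow> real^'p::finite^'p"
    and Ystar :: "real^'p^'p"
  assumes p_gt_1: "CARD('p) > 1"
    and symmetric: "\<And>m. A m \<in> sym_mats"
    and consistent: "consistent A"
    and max_slack: "max_slack A Ystar"
  shows "subspace (gen_cone (coeff_vec A ` immobile_indices A)) \<longleftrightarrow>
    (\<exists>Ustar \<in> null_mats A \<inter> CP. strictly_complementary Ustar Ystar)"
proof -
  let ?K = "CP \<inter> mat_perp Ystar"
  let ?L = "gen_cone (coeff_vec A ` immobile_indices A)"
  define \<phi> :: "real^'p^'p \<Rightarrow> real^('n option)" where "\<phi> U = (\<chi> m. mat_inner (A m) U)" for U
  have lin: "linear \<phi>"
    by (rule linearI)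
       (simp_all add: \<phi>_def vec_eq_iff linear_add[OF linear_mat_inner]
          linear_scale[OF linear_mat_inner])
  have "coeff_vec A ` immobile_indices A = \<phi> ` outer_sq ` immobile_indices A"
    by (simp add: image_image \<phi>_def coeff_vec_def mat_inner_outer_sq)
  then have "?L = \<phi> ` (convex_cone hull (outer_sq ` immobile_indices A))"
    by (simp add: gen_cone_eq_convex_cone_hull convex_cone_hull_linear_image lin)
  also have "\<dots> = \<phi> ` ?K"
    using CP_face_eq_convex_cone_hull[OF max_slack_COP[OF max_slack]]
      immobile_indices_eq_zeros[OF max_slack] by simp
  finally have L: "?L = \<phi> ` ?K" .
  have "convex ?K" using convex_cone_CP_face[of Ystar] by (simp add: convex_cone_def)
  have "subspace ?L \<longleftrightarrow> 0 \<in> rel_interior (\<phi> ` ?K)"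
    using subspace_iff_zero_in_rel_interior[of ?L] L
    by (simp add: gen_cone_eq_convex_cone_hull convex_cone_convex_cone_hull)
  also have "\<dots> \<longleftrightarrow> (\<exists>U \<in> rel_interior ?K. \<phi> U = 0)"
    unfolding rel_interior_convex_linear_image[OF lin \<open>convex ?K\<close>, symmetric]
    by (force simp: image_iff)
  also have "\<dots> \<longleftrightarrow> (\<exists>U \<in> null_mats A \<inter> CP. strictly_complementary U Ystar)"
  proof -
    have "\<phi> U = 0 \<longleftrightarrow> U \<in> null_mats A \<inter> CP" if "U \<in> rel_interior ?K" for U
    proof -
      have "U \<in> CP" "U \<in> sym_mats" using that rel_interior_subset CP_sym by blast+
      then show ?thesis by (simp add: null_mats_def \<phi>_def vec_eq_iff)
    qed
    then show ?thesis unfolding strictly_complementary_def by blast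
  qed
  finally show ?thesis .
qed

end
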